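(* Let $U_1,\dots,U_m$ ($m\ge 1$) be affine subspaces of $\mathbb{R}^n$ with nonempty intersection $S:=\bigcap_{i=1}^m U_i$, let $\mathbf{B}=(\mathcal{B}_1,\dots,\mathcal{B}_p)$ be an ordered collection of blocks for the ordered affine subspaces $U_1,\dots,U_m$, and let $C_{\mathbf{B}}:\mathbb{R}^n\to\mathbb{R}^n$ be the block-wise circumcentered-reflection operator regarding $\mathbf{B}$. Then there exists a constant $r_{\mathbf{B}}\in[0,1)$ such that $$\|C_{\mathbf{B}}(z)-P_S(z)\|\le r_{\mathbf{B}}\,\|z-P_S(z)\|\quad\text{for all } z\in\mathbb{R}^n .$$ Moreover, for all $z\in\mathbb{R}^n$, $P_S(C_{\mathbf{B}}(z))=P_S(z)$, and the sequence $(C_{\mathbf{B}}^k(z))_{k\in\mathbb{N}}$ converges linearly to $P_S(z)$, i.e. $\lim_{k\to\infty}C_{\mathbf{B}}^k(z)=P_S(z)$, with global Q-linear rate $r_{\mathbf{B}}$, i.e. for all $k\in\mathbb{N}$, $$\|C_{\mathbf{B}}^k(z)-P_S(z)\|\le r_{\mathbf{B}}^k\,\|z-P_S(z)\|.$$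
   Context: $\|\cdot\|$ is the Euclidean norm on $\mathbb{R}^n$. For a nonempty affine subspace $U$, $P_U$ is the Euclidean (orthogonal) projection onto $U$, and $R_U:=2P_U-\mathrm{Id}$ is the reflection onto $U$. $\mathrm{aff}$ denotes affine hull; $T^k$ is the $k$-fold composition of an operator $T$. Circumcenter of a block. Let $\mathcal{B}=(V_1,\dots,V_q)$, $q\ge1$, be an ordered block of affine subspaces with nonempty intersection. For $z\in\mathbb{R}^n$, the circumcenter $C_{\mathcal{B}}(z)$ is the point defined by: (i) $C_{\mathcal{B}}(z)\in \mathrm{aff}\{z,R_{V_1}(z),R_{V_2}R_{V_1}(z),\dots,R_{V_q}\cdots R_{V_2}R_{V_1}(z)\}$; (ii) $\|z-C_{\mathcal{B}}(z)\|=\|R_{V_1}(z)-C_{\mathcal{B}}(z)\|=\cdots=\|R_{V_q}\cdots R_{V_2}R_{V_1}(z)-C_{\mathcal{B}}(z)\|$. (It is known that such a point exists and is unique when the intersection of the block is nonempty.) Ordered collection of blocks. $\mathbf{B}=(\mathcal{B}_1,\dots,\mathcal{B}_p)$ is an ordered collection of blocks for $U_1,\dots,U_m$ if there are integers $0=q_0<q_1<\cdots<q_p=m$ with $\mathcal{B}_j=(U_{q_{j-1}+1},U_{q_{j-1}+2},\dots,U_{q_j})$ for $j=1,\dots,p$. Block-wise circumcentered-reflection operator: $C_{\mathbf{B}}:=C_{\mathcal{B}_p}\circ C_{\mathcal{B}_{p-1}}\circ\cdots\circ C_{\mathcal{B}_2}\circ C_{\mathcal{B}_1}$. *)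

theory Defs
  imports "HOL-Analysis.Analysis"
begin

definition reflection :: "'a::euclidean_space set \<Rightarrow> 'a \<Rightarrow> 'a" where
  "reflection V z = 2 *\<^sub>R closest_point V z - z"

(* [z, R_V1 z, R_V2 (R_V1 z), ...] for the block [V1, V2, ...] *)
fun reflections :: "'a::euclidean_space set list \<Rightarrow> 'a \<Rightarrow> 'a list" where
  "reflections [] z = [z]"
| "reflections (V # Vs) z = z # reflections Vs (reflection V z)"

(* The description is proper for nonempty blocks of affine subspaces with a common point;
   for other arguments the value carries no information. *)
definition circumcenter :: "'a::euclidean_space set list \<Rightarrow> 'a \<Rightarrow> 'a" where
  "circumcenter Vs z =
     (THE c. c \<in> affine hull (set (reflections Vs z)) \<and>
             (\<forall>x \<in> set (reflections Vs z). norm (x - c) = norm (z - c)))"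

(* The subspaces are indexed 1, ..., m, while the list of p blocks is indexed 0, ..., p - 1:
   entry j consists of U (q j + 1), ..., U (q (j + 1)). *)
definition ordered_blocks :: "(nat \<Rightarrow> 'a set) \<Rightarrow> nat \<Rightarrow> 'a set list list \<Rightarrow> bool" where
  "ordered_blocks U m Bs \<longleftrightarrow>
     (\<exists>q :: nat \<Rightarrow> nat. q 0 = 0 \<and> q (length Bs) = m \<and>
        (\<forall>j < length Bs. q j < q (Suc j)) \<and>
        (\<forall>j < length Bs. Bs ! j = map U [Suc (q j) ..< Suc (q (Suc j))]))"

(* fold applies the circumcenter operator of the first block first. *)
definition block_crm :: "'a::euclidean_space set list list \<Rightarrow> 'a \<Rightarrow> 'a" where
  "block_crm Bs = fold circumcenter Bs"

end

theory Submission
  imports Defs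
begin

text \<open>
  The engine is a Pythagorean identity. Let \<open>c\<close> be the circumcenter of a block at \<open>z\<close>, and let \<open>w\<close>
  be any common point of the block. Reflections onto subspaces through \<open>w\<close> preserve the distance
  to \<open>w\<close>, so the projection of \<open>w\<close> onto the affine hull of the successive reflections is
  equidistant from all of them; by uniqueness, this projection is \<open>c\<close>, whatever \<open>w\<close> was. Hence
  \<open>norm (c - w)^2 = norm (z - w)^2 - norm (z - c)^2\<close>. Over all blocks, one application of the
  operator lowers the squared distance to \<^emph>\<open>every\<close> point of the intersection \<open>S\<close> by the same
  amount \<open>E\<close>, the sum of the squared step lengths (\<open>block_crm_decrease\<close>). Since \<open>E\<close> does not depend
  on the point, the nearest point of \<open>S\<close> does not move.

  For a contraction, \<open>E\<close> must be bounded below by a multiple of the squared distance from \<open>z\<close> to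
  \<open>S\<close>. A step of length \<open>d\<close> forces \<open>z\<close> to be within \<open>3 * d\<close> of every subspace of the block: all the
  reflections lie on a sphere of radius \<open>d\<close> around \<open>c\<close>, so any two of them are at most \<open>2 * d\<close>
  apart, and the subspace contains the midpoint of two consecutive ones
  (\<open>infdist_le_circumcenter_step\<close>). If all the steps are short, then \<open>z\<close> is close to every
  \<open>U i\<close>. Finitely many affine subspaces with a common point are linearly regular: the distance to
  their intersection is at most a constant times the sum of the distances to them
  (\<open>affine_linear_regularity\<close>), by compactness of the unit sphere and scaling. This gives the
  bound on \<open>E\<close>. The circumcenter is in general not a continuous function of \<open>z\<close>; compactness is
  applied to distance functions only.
\<close>

section \<open>Distances and projections for affine subspaces\<close>

lemma affine_closest_point_orthogonal:
  fixes A :: "'a::euclidean_space set"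
  assumes "affine A" "x \<in> A"
  shows "(a - closest_point A a) \<bullet> (x - closest_point A a) = 0"
proof -
  let ?c = "closest_point A a"
  have cl: "closed A" and cv: "convex A"
    using assms(1) affine_closed affine_imp_convex by auto
  have c: "?c \<in> A" using closest_point_in_set[OF cl] assms(2) by blast
  \<comment> \<open>The variational inequality also applies to the mirror image of \<open>x\<close> in the projection.\<close>
  have "2 *\<^sub>R ?c + (-1) *\<^sub>R x \<in> A"
    using mem_affine[OF assms(1) c assms(2), of 2 "-1"] by simp
  from closest_point_dot[OF cv cl this, of a] closest_point_dot[OF cv cl assms(2), of a]
  show ?thesis by (simp add: algebra_simps scaleR_2)
qed

lemma infdist_eq_norm_closest_point:
  fixes A :: "'a::euclidean_space set"
  assumes "closed A" "A \<noteq> {}"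
  shows "infdist z A = norm (z - closest_point A z)"
  using setdist_closest_point[OF assms, of z] by (simp add: infdist_eq_setdist dist_norm)

lemma norm_reflection_diff:
  fixes V :: "'a::euclidean_space set"
  assumes "affine V" "w \<in> V"
  shows "norm (reflection V z - w) = norm (z - w)"
proof -
  let ?p = "closest_point V z"
  have o: "(z - ?p) \<bullet> (w - ?p) = 0"
    using affine_closest_point_orthogonal[OF assms] .
  have "(reflection V z - w) \<bullet> (reflection V z - w)
      = (z - w) \<bullet> (z - w) + 4 * ((z - ?p) \<bullet> (w - ?p))"
    unfolding reflection_def
    by (simp add: inner_diff_left inner_diff_right inner_add_left inner_add_right inner_commute
        algebra_simps)
  with o show ?thesis by (simp add: norm_eq)
qed

lemma infdist_eq_reflection:
  fixes V :: "'a::euclidean_space set"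
  assumes "affine V" "V \<noteq> {}"
  shows "2 * infdist z V = norm (reflection V z - z)"
proof -
  have "reflection V z - z = 2 *\<^sub>R (closest_point V z - z)"
    by (simp add: reflection_def scaleR_2 algebra_simps)
  then have "norm (reflection V z - z) = 2 * norm (closest_point V z - z)"
    by (metis norm_scaleR abs_numeral)
  with infdist_eq_norm_closest_point[OF affine_closed[OF assms(1)] assms(2), of z]
  show ?thesis by (simp add: norm_minus_commute)
qed

text \<open>An affine subspace is invariant under the homothety that takes one of its points \<open>p\<close> to
  another one \<open>s\<close> and scales by \<open>t\<close>, and distances scale by \<open>t\<close>.\<close>
lemma infdist_homothety_le:
  fixes A :: "'a::euclidean_space set"
  assumes "affine A" "s \<in> A" "p \<in> A" "0 \<le> t"
  shows "infdist (s + t *\<^sub>R (z - p)) A \<le> t * infdist z A"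
proof -
  let ?u = "closest_point A z"
  have cl: "closed A" "A \<noteq> {}" using assms affine_closed by auto
  have u: "?u \<in> A" using closest_point_in_set cl by blast
  have "s + t *\<^sub>R (?u - p) \<in> A"
    using mem_affine_3_minus[OF assms(1,2) u assms(3)] .
  then have "infdist (s + t *\<^sub>R (z - p)) A \<le> dist (s + t *\<^sub>R (z - p)) (s + t *\<^sub>R (?u - p))"
    by (rule infdist_le)
  also have "\<dots> = norm (t *\<^sub>R (z - ?u))"
    by (simp add: dist_norm algebra_simps)
  also have "\<dots> = t * infdist z A"
    using assms(4) infdist_eq_norm_closest_point[OF cl] by simp
  finally show ?thesis .
qed

text \<open>Fix a common point \<open>s\<close>. The points at distance 1 from \<open>s\<close> whose nearest common point is \<open>s\<close>
  form a compact set \<open>K\<close> outside the intersection, where the sum of the distances has a positive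
  minimum. A homothety as in \<open>infdist_homothety_le\<close> takes any \<open>z\<close> outside the intersection into
  \<open>K\<close>, and it scales all the distances by the same factor.\<close>
lemma affine_linear_regularity:
  fixes U :: "'i \<Rightarrow> 'a::euclidean_space set"
  assumes I: "finite I" and aff: "\<And>i. i \<in> I \<Longrightarrow> affine (U i)"
    and ne: "(\<Inter>i\<in>I. U i) \<noteq> {}"
  obtains M where "0 \<le> M" "\<And>z. infdist z (\<Inter>i\<in>I. U i) \<le> M * (\<Sum>i\<in>I. infdist z (U i))"
proof -
  define S where "S = (\<Inter>i\<in>I. U i)"
  define f where "f y = (\<Sum>i\<in>I. infdist y (U i))" for y
  have f0: "0 \<le> f y" for y unfolding f_def by (intro sum_nonneg infdist_nonneg)
  obtain s where s: "s \<in> S" using ne unfolding S_def by blast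
  have affS: "affine S" unfolding S_def using aff by (intro affine_Inter) auto
  have clS: "closed S" "S \<noteq> {}" using affS affine_closed s by auto
  \<comment> \<open>Distance at least 1 from \<open>S\<close> says that no point of \<open>S\<close> is nearer than \<open>s\<close>.\<close>
  define K where "K = sphere s 1 \<inter> (\<lambda>y. infdist y S) -` {1..}"
  have "compact K" unfolding K_def
    by (intro compact_Int_closed compact_sphere continuous_closed_vimage closed_atLeast
        continuous_infdist continuous_ident)
  have "continuous_on K f" unfolding f_def
    by (intro continuous_intros)
  have pos: "0 < f y" if "y \<in> K" for y
  proof (rule ccontr)
    assume "\<not> 0 < f y"
    then have "f y = 0" using f0[of y] by simp
    then have "\<forall>i\<in>I. infdist y (U i) = 0"
      unfolding f_def using sum_nonneg_eq_0_iff[OF I] infdist_nonneg by metis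
    then have "y \<in> U i" if "i \<in> I" for i
      using that in_closed_iff_infdist_zero[OF affine_closed[OF aff[OF that]]] s
      unfolding S_def by auto
    then have "y \<in> S" unfolding S_def by blast
    then have "infdist y S = 0" by simp
    then show False using that unfolding K_def by simp
  qed
  obtain \<mu> where mu: "0 < \<mu>" "\<And>y. y \<in> K \<Longrightarrow> \<mu> \<le> f y"
  proof (cases "K = {}")
    case True
    then show ?thesis using that[of 1] by simp
  next
    case False
    obtain y0 where "y0 \<in> K" "\<forall>y\<in>K. f y0 \<le> f y"
      using continuous_attains_inf[OF \<open>compact K\<close> False \<open>continuous_on K f\<close>] by blast
    then show ?thesis using that[of "f y0"] pos by blast
  qed
  have "infdist z S \<le> (1 / \<mu>) * f z" for z
  proof (cases "infdist z S = 0")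
    case True
    then show ?thesis using f0[of z] mu(1) by simp
  next
    case False
    define d where "d = infdist z S"
    have d: "0 < d" using False infdist_nonneg[of z S] unfolding d_def by linarith
    define p where "p = closest_point S z"
    have p: "p \<in> S" unfolding p_def using closest_point_in_set clS by blast
    have dn: "d = norm (z - p)" unfolding d_def p_def
      by (rule infdist_eq_norm_closest_point[OF clS])
    define y where "y = s + (1 / d) *\<^sub>R (z - p)"
    have "norm (y - s) = 1" unfolding y_def using d dn by simp
    moreover have "1 \<le> infdist y S"
    proof -
      have "p + d *\<^sub>R (y - s) = z" unfolding y_def using d by simp
      then have "d \<le> d * infdist y S"
        using infdist_homothety_le[OF affS p s, of d y] d unfolding d_def by simp
      then show ?thesis using d by simp
    qed
    ultimately have "y \<in> K" unfolding K_def by (simp add: dist_norm norm_minus_commute)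
    then have "\<mu> \<le> f y" by (rule mu(2))
    also have "f y \<le> (\<Sum>i\<in>I. (1 / d) * infdist z (U i))" unfolding f_def y_def
    proof (rule sum_mono)
      fix i assume "i \<in> I"
      then show "infdist (s + (1 / d) *\<^sub>R (z - p)) (U i) \<le> (1 / d) * infdist z (U i)"
        using infdist_homothety_le[OF aff, of i s p "1 / d" z] s p d unfolding S_def by simp
    qed
    also have "\<dots> = (1 / d) * f z" unfolding f_def by (simp add: sum_distrib_left)
    finally show ?thesis using d mu(1) unfolding d_def[symmetric] by (simp add: field_simps)
  qed
  then show ?thesis using that[of "1 / \<mu>"] mu(1) unfolding S_def f_def by simp
qed

section \<open>The circumcenter of one block\<close>

lemma self_in_reflections: "z \<in> set (reflections Vs z)"
  by (cases Vs) auto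

lemma reflections_equidistant:
  assumes "\<And>V. V \<in> set Vs \<Longrightarrow> affine V \<and> w \<in> V" "x \<in> set (reflections Vs z)"
  shows "norm (x - w) = norm (z - w)"
  using assms
proof (induction Vs arbitrary: z)
  case Nil
  then show ?case by simp
next
  case (Cons V Vs)
  show ?case
  proof (cases "x = z")
    case False
    then have "norm (x - w) = norm (reflection V z - w)" using Cons by simp
    then show ?thesis using norm_reflection_diff[of V w z] Cons.prems(1) by simp
  qed simp
qed

text \<open>The difference of two such centers lies in the direction space of the affine hull, and
  equidistance makes it orthogonal to that space.\<close>
lemma equidistant_point_unique:
  fixes X :: "'a::euclidean_space set"
  assumes c: "c \<in> affine hull X" "\<And>x. x \<in> X \<Longrightarrow> norm (x - c) = norm (z - c)"
    and d: "d \<in> affine hull X" "\<And>x. x \<in> X \<Longrightarrow> norm (x - d) = norm (z - d)"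
  shows "c = d"
proof -
  let ?H = "{x. (c - d) \<bullet> x = (c - d) \<bullet> z}"
  have "x \<in> ?H" if "x \<in> X" for x
  proof -
    have "(x - c) \<bullet> (x - c) = (z - c) \<bullet> (z - c)" "(x - d) \<bullet> (x - d) = (z - d) \<bullet> (z - d)"
      using c(2)[OF that] d(2)[OF that] by (simp_all add: norm_eq)
    then show ?thesis
      by (simp add: inner_diff_left inner_diff_right inner_commute)
  qed
  then have "affine hull X \<subseteq> ?H"
    by (intro hull_minimal affine_hyperplane) auto
  then have "c \<in> ?H" "d \<in> ?H" using c(1) d(1) by blast+
  then have "(c - d) \<bullet> c = (c - d) \<bullet> d" by (simp only: mem_Collect_eq)
  then have "(c - d) \<bullet> (c - d) = 0" by (simp add: inner_diff_right)
  then show ?thesis by simp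
qed

text \<open>All common points \<open>w\<close> of the block have the same projection onto the affine hull, since each
  of these projections solves the problem that determines the circumcenter.\<close>
lemma circumcenter_eq_closest_point:
  assumes "\<And>V. V \<in> set Vs \<Longrightarrow> affine V \<and> w \<in> V"
  shows "circumcenter Vs z = closest_point (affine hull (set (reflections Vs z))) w"
    and "x \<in> set (reflections Vs z) \<Longrightarrow> norm (x - circumcenter Vs z) = norm (z - circumcenter Vs z)"
proof -
  let ?X = "set (reflections Vs z)"
  let ?A = "affine hull ?X"
  let ?c = "closest_point ?A w"
  have zX: "z \<in> ?X" by (rule self_in_reflections)
  have XA: "?X \<subseteq> ?A" by (rule hull_subset)
  have cl: "closed ?A" by (rule affine_closed) simp
  have cA: "?c \<in> ?A" using closest_point_in_set[OF cl] zX XA by blast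
  have pyth: "norm (x - w)^2 = norm (x - ?c)^2 + norm (w - ?c)^2" if "x \<in> ?X" for x
  proof -
    have "(w - ?c) \<bullet> (x - ?c) = 0"
      using affine_closest_point_orthogonal[of ?A x w] that XA by auto
    then show ?thesis
      by (simp add: power2_norm_eq_inner inner_diff_left inner_diff_right inner_commute)
  qed
  have eq: "norm (x - ?c) = norm (z - ?c)" if "x \<in> ?X" for x
  proof -
    have "norm (x - ?c)^2 = norm (z - ?c)^2"
      using pyth[OF that] pyth[OF zX] reflections_equidistant[OF assms that] by simp
    then show ?thesis by simp
  qed
  show circ: "circumcenter Vs z = ?c"
    unfolding circumcenter_def
  proof (rule the_equality)
    show "?c \<in> ?A \<and> (\<forall>x\<in>?X. norm (x - ?c) = norm (z - ?c))" using cA eq by blast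
  next
    fix d assume "d \<in> ?A \<and> (\<forall>x\<in>?X. norm (x - d) = norm (z - d))"
    then show "d = ?c" using equidistant_point_unique[of d ?X z ?c] cA eq by blast
  qed
  show "norm (x - circumcenter Vs z) = norm (z - circumcenter Vs z)" if "x \<in> ?X"
    using eq[OF that] by (simp only: circ)
qed

lemma circumcenter_pythagoras:
  assumes "\<And>V. V \<in> set Vs \<Longrightarrow> affine V \<and> w \<in> V"
  shows "norm (circumcenter Vs z - w)^2 = norm (z - w)^2 - norm (z - circumcenter Vs z)^2"
proof -
  let ?A = "affine hull (set (reflections Vs z))"
  have "z \<in> ?A" using self_in_reflections by (rule hull_inc)
  moreover have "circumcenter Vs z = closest_point ?A w"
    using assms by (rule circumcenter_eq_closest_point(1))
  ultimately have "(w - circumcenter Vs z) \<bullet> (z - circumcenter Vs z) = 0"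
    using affine_closest_point_orthogonal[of ?A z w] by simp
  then show ?thesis
    by (simp add: power2_norm_eq_inner inner_diff_left inner_diff_right inner_commute)
qed

lemma reflections_consecutive:
  assumes "V \<in> set Vs"
  obtains x where "x \<in> set (reflections Vs z)" "reflection V x \<in> set (reflections Vs z)"
  using assms
proof (induction Vs arbitrary: z thesis)
  case Nil
  then show ?case by simp
next
  case (Cons V' Vs)
  show ?case
  proof (cases "V = V'")
    case True
    then show ?thesis using Cons.prems(1)[of z] self_in_reflections[of "reflection V' z" Vs] by simp
  next
    case False
    then obtain x where "x \<in> set (reflections Vs (reflection V' z))"
        "reflection V x \<in> set (reflections Vs (reflection V' z))"
      using Cons.IH[of "reflection V' z"] Cons.prems(2) by auto
    then show ?thesis using Cons.prems(1)[of x] by simp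
  qed
qed

text \<open>With \<open>d\<close> the length of the step, the reflections \<open>x\<close> and \<open>reflection V x\<close> are at distance \<open>d\<close>
  from the circumcenter, hence at most \<open>2 * d\<close> apart, and \<open>V\<close> contains their midpoint; moreover
  \<open>z\<close> is at most \<open>2 * d\<close> away from \<open>x\<close>.\<close>
lemma infdist_le_circumcenter_step:
  assumes Vs: "\<And>V. V \<in> set Vs \<Longrightarrow> affine V \<and> w \<in> V" and V: "V \<in> set Vs"
  shows "infdist z V \<le> 3 * norm (z - circumcenter Vs z)"
proof -
  let ?c = "circumcenter Vs z"
  obtain x where x: "x \<in> set (reflections Vs z)" "reflection V x \<in> set (reflections Vs z)"
    using reflections_consecutive[OF V] .
  have eq: "norm (y - ?c) = norm (z - ?c)" if "y \<in> set (reflections Vs z)" for y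
    using Vs that by (rule circumcenter_eq_closest_point(2))
  have "2 * infdist x V = norm ((reflection V x - ?c) - (x - ?c))"
    using infdist_eq_reflection[of V x] Vs[OF V] by auto
  also have "\<dots> \<le> norm (reflection V x - ?c) + norm (x - ?c)" by (rule norm_triangle_ineq4)
  also have "\<dots> = 2 * norm (z - ?c)" using eq[OF x(1)] eq[OF x(2)] by simp
  finally have 1: "infdist x V \<le> norm (z - ?c)" by simp
  have "dist z x \<le> dist z ?c + dist x ?c" by (rule dist_triangle2)
  also have "\<dots> = 2 * norm (z - ?c)" using eq[OF x(1)] by (simp add: dist_norm)
  finally have 2: "dist z x \<le> 2 * norm (z - ?c)" .
  have "infdist z V \<le> infdist x V + dist z x" by (rule infdist_triangle)
  with 1 2 show ?thesis by linarith
qed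

section \<open>The block-wise operator\<close>

text \<open>Here \<open>E\<close> is the sum of the squared step lengths. A subspace of a later block is compared with
  \<open>z\<close> by way of the intermediate point; \<open>(a + b)^2 \<le> 2 * a^2 + 2 * b^2\<close> costs a factor 2 for
  each block.\<close>
lemma block_crm_decrease:
  fixes Bs :: "'a::euclidean_space set list list"
  assumes S: "S \<noteq> {}" and Bs: "\<And>V. V \<in> set (concat Bs) \<Longrightarrow> affine V \<and> S \<subseteq> V"
  shows "\<exists>E\<ge>0. (\<forall>w\<in>S. norm (block_crm Bs z - w)^2 = norm (z - w)^2 - E) \<and>
               (\<forall>V\<in>set (concat Bs). (infdist z V)^2 \<le> 9 * 2 ^ length Bs * E)"
  using Bs
proof (induction Bs arbitrary: z)
  case Nil
  show ?case by (intro exI[of _ 0]) (simp add: block_crm_def)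
next
  case (Cons B Bs)
  define c where "c = circumcenter B z"
  define \<delta> where "\<delta> = norm (z - c)"
  have B: "affine V \<and> w \<in> V" if "w \<in> S" "V \<in> set B" for V w
    using Cons.prems[of V] that by auto
  have "\<exists>E\<ge>0. (\<forall>w\<in>S. norm (block_crm Bs c - w)^2 = norm (c - w)^2 - E) \<and>
               (\<forall>V\<in>set (concat Bs). (infdist c V)^2 \<le> 9 * 2 ^ length Bs * E)"
    using Cons.prems by (intro Cons.IH) simp
  then obtain E where E: "0 \<le> E"
    "\<And>w. w \<in> S \<Longrightarrow> norm (block_crm Bs c - w)^2 = norm (c - w)^2 - E"
    "\<And>V. V \<in> set (concat Bs) \<Longrightarrow> (infdist c V)^2 \<le> 9 * 2 ^ length Bs * E" by blast
  define P :: real where "P = 2 ^ length Bs"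
  have P: "1 \<le> P" unfolding P_def by simp
  have step: "block_crm (B # Bs) z = block_crm Bs c" by (simp add: block_crm_def c_def)
  have "norm (block_crm (B # Bs) z - w)^2 = norm (z - w)^2 - (\<delta>^2 + E)" if "w \<in> S" for w
    using E(2)[OF that] circumcenter_pythagoras[of B w z] B[OF that]
    unfolding step \<delta>_def c_def by simp
  moreover have "(infdist z V)^2 \<le> 9 * 2 ^ length (B # Bs) * (\<delta>^2 + E)"
    if V: "V \<in> set (concat (B # Bs))" for V
  proof -
    obtain w where w: "w \<in> S" using S by blast
    have \<delta>P: "\<delta>^2 \<le> P * \<delta>^2" using P mult_right_mono[of 1 P "\<delta>^2"] by simp
    have PE: "0 \<le> P * E" using P E(1) by simp
    have "(infdist z V)^2 \<le> 18 * (P * \<delta>^2) + 18 * (P * E)"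
    proof (cases "V \<in> set B")
      case True
      then have "infdist z V \<le> 3 * \<delta>"
        unfolding \<delta>_def c_def using infdist_le_circumcenter_step[of B w V z] B[OF w] by blast
      then have "(infdist z V)^2 \<le> (3 * \<delta>)^2" by (intro power_mono infdist_nonneg)
      also have "\<dots> = 9 * \<delta>^2" by (simp add: power2_eq_square)
      finally show ?thesis using \<delta>P PE zero_le_power2[of \<delta>] by linarith
    next
      case False
      then have V': "V \<in> set (concat Bs)" using V by simp
      have "infdist z V \<le> infdist c V + \<delta>"
        using infdist_triangle[of z V c] unfolding \<delta>_def by (simp add: dist_norm)
      then have "(infdist z V)^2 \<le> (infdist c V + \<delta>)^2" by (intro power_mono infdist_nonneg)
      also have "\<dots> \<le> 2 * (infdist c V)^2 + 2 * \<delta>^2"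
        using zero_le_power2[of "infdist c V - \<delta>"] by (simp add: power2_eq_square algebra_simps)
      finally show ?thesis
        using E(3)[OF V'] \<delta>P zero_le_power2[of \<delta>]
        unfolding P_def[symmetric] mult.assoc by linarith
    qed
    then show ?thesis unfolding P_def by (simp add: algebra_simps)
  qed
  ultimately show ?case using E(1) by (intro exI[of _ "\<delta>^2 + E"]) auto
qed

lemma concat_ordered_blocks:
  assumes "ordered_blocks U m Bs"
  shows "concat Bs = map U [1..<Suc m]"
proof -
  obtain q where q: "q 0 = 0" "q (length Bs) = m" "\<And>j. j < length Bs \<Longrightarrow> q j < q (Suc j)"
    "\<And>j. j < length Bs \<Longrightarrow> Bs ! j = map U [Suc (q j)..<Suc (q (Suc j))]"
    using assms unfolding ordered_blocks_def by blast
  have "concat (take n Bs) = map U [1..<Suc (q n)]" if "n \<le> length Bs" for n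
    using that
  proof (induction n)
    case 0
    then show ?case by (simp add: q(1))
  next
    case (Suc n)
    have "[1..<Suc (q (Suc n))] = [1..<Suc (q n)] @ [Suc (q n)..<Suc (q (Suc n))]"
      using q(3)[of n] Suc.prems upt_add_eq_append[of 1 "Suc (q n)" "q (Suc n) - q n"] by simp
    then show ?case
      using Suc q(4)[of n] by (simp add: take_Suc_conv_app_nth del: upt_Suc)
  qed
  from this[of "length Bs"] show ?thesis by (simp add: q(2))
qed

text \<open>If \<open>norm (x - w)^2 - norm (y - w)^2\<close> is constant for \<open>w\<close> in \<open>S\<close>, then the same \<open>w\<close> minimises
  both distances.\<close>
lemma closest_point_eq_if_power2_diff_const:
  fixes S :: "'a::euclidean_space set"
  assumes S: "affine S" "S \<noteq> {}"
    and E: "\<And>w. w \<in> S \<Longrightarrow> norm (y - w)^2 = norm (x - w)^2 - E"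
  shows "closest_point S y = closest_point S x"
proof -
  have cl: "closed S" and cv: "convex S" using S affine_closed affine_imp_convex by auto
  have p: "closest_point S x \<in> S" using closest_point_in_set cl S(2) .
  have "dist y (closest_point S x) \<le> dist y w" if "w \<in> S" for w
  proof -
    have "norm (x - closest_point S x) \<le> norm (x - w)"
      using closest_point_le[OF cl that, of x] by (simp add: dist_norm)
    then have "norm (x - closest_point S x)^2 \<le> norm (x - w)^2" by (simp add: power_mono)
    then have "norm (y - closest_point S x)^2 \<le> norm (y - w)^2"
      using E[OF p] E[OF that] by simp
    then show ?thesis by (simp add: dist_norm)
  qed
  then show ?thesis using closest_point_unique[OF cv cl p] by force
qed

theorem theorem3:
  fixes U :: "nat \<Rightarrow> (real ^ 'n) set"
    and m :: nat
    and S :: "(real ^ 'n) set"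
    and Bs :: "(real ^ 'n) set list list"
  assumes "m \<ge> 1"
    and "\<And>i. i \<in> {1..m} \<Longrightarrow> affine (U i)"
    and "S = (\<Inter>i\<in>{1..m}. U i)"
    and "S \<noteq> {}"
    and "ordered_blocks U m Bs"
  shows "\<exists>r. 0 \<le> r \<and> r < 1 \<and>
    (\<forall>z. norm (block_crm Bs z - closest_point S z) \<le> r * norm (z - closest_point S z)) \<and>
    (\<forall>z. closest_point S (block_crm Bs z) = closest_point S z \<and>
         (\<lambda>k. (block_crm Bs ^^ k) z) \<longlonglongrightarrow> closest_point S z \<and>
         (\<forall>k. norm ((block_crm Bs ^^ k) z - closest_point S z)
               \<le> r ^ k * norm (z - closest_point S z)))"
proof -
  let ?T = "block_crm Bs" and ?P = "closest_point S"
  have affS: "affine S" unfolding assms(3) using assms(2) by (intro affine_Inter) auto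
  have clS: "closed S" using affS by (rule affine_closed)
  have PS: "?P z \<in> S" for z using closest_point_in_set clS assms(4) .
  have set: "set (concat Bs) = U ` {1..m}"
    using concat_ordered_blocks[OF assms(5)] by (simp add: atLeastLessThanSuc_atLeastAtMost del: upt_Suc)
  obtain M where M: "0 \<le> M" "\<And>z. infdist z S \<le> M * (\<Sum>i\<in>{1..m}. infdist z (U i))"
    using affine_linear_regularity[of "{1..m}" U] assms(2-4) by auto
  define K :: real where "K = 9 * 2 ^ length Bs"
  have K: "0 \<le> K" unfolding K_def by simp
  define L where "L = (M * real m)^2 * K"
  have L: "0 \<le> L" unfolding L_def using K by simp
  \<comment> \<open>The bound \<open>(infdist z S)^2 \<le> L * E\<close> leaves at most the fraction \<open>L / (L + 1)\<close> of the squared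
      distance after the decrease by \<open>E\<close>; \<open>L + 1\<close> keeps the denominator positive.\<close>
  define r where "r = sqrt (L / (L + 1))"
  have r: "0 \<le> r" "r < 1" unfolding r_def using L by (simp_all add: real_less_lsqrt)
  have main: "?P (?T z) = ?P z \<and> norm (?T z - ?P z) \<le> r * norm (z - ?P z)" for z
  proof -
    have "affine V \<and> S \<subseteq> V" if "V \<in> set (concat Bs)" for V
      using that assms(2,3) unfolding set by auto
    with block_crm_decrease[OF assms(4), of Bs z] obtain E where E: "0 \<le> E" "\<And>w. w \<in> S \<Longrightarrow> norm (?T z - w)^2 = norm (z - w)^2 - E"
      "\<And>V. V \<in> set (concat Bs) \<Longrightarrow> (infdist z V)^2 \<le> K * E"
      unfolding K_def by blast
    define d where "d = norm (z - ?P z)"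
    have "d = infdist z S" unfolding d_def
      using infdist_eq_norm_closest_point[OF clS assms(4)] by simp
    also have "\<dots> \<le> M * (\<Sum>i\<in>{1..m}. infdist z (U i))" by (rule M(2))
    also have "\<dots> \<le> M * (\<Sum>i\<in>{1..m}. sqrt (K * E))"
    proof (intro mult_left_mono sum_mono M(1))
      fix i assume "i \<in> {1..m}"
      then have "U i \<in> set (concat Bs)" unfolding set by (rule imageI)
      then show "infdist z (U i) \<le> sqrt (K * E)" using E(3) by (intro real_le_rsqrt)
    qed
    also have "\<dots> = M * real m * sqrt (K * E)" by simp
    finally have "d^2 \<le> (M * real m * sqrt (K * E))^2"
      unfolding d_def by (intro power_mono norm_ge_zero)
    also have "\<dots> = L * E" unfolding L_def using K E(1) by (simp add: power_mult_distrib)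
    finally have dE: "d^2 \<le> L * E" .
    have "norm (?T z - ?P z)^2 = d^2 - E" unfolding d_def using E(2)[OF PS] .
    also have "\<dots> \<le> L / (L + 1) * d^2" using dE L E(1) by (simp add: field_simps)
    also have "\<dots> = (r * d)^2" unfolding r_def using L by (simp add: power_mult_distrib)
    finally have "norm (?T z - ?P z) \<le> r * d"
      by (rule power2_le_imp_le) (simp add: r(1) d_def)
    moreover have "?P (?T z) = ?P z"
      using closest_point_eq_if_power2_diff_const[OF affS assms(4) E(2)] .
    ultimately show ?thesis unfolding d_def by simp
  qed
  have fixed: "?P ((?T ^^ k) z) = ?P z" for k z
    by (induction k) (simp_all add: main)
  have iter: "norm ((?T ^^ k) z - ?P z) \<le> r ^ k * norm (z - ?P z)" for k z
  proof (induction k)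
    case (Suc k)
    have "norm ((?T ^^ Suc k) z - ?P z) \<le> r * norm ((?T ^^ k) z - ?P z)"
      using main[of "(?T ^^ k) z"] by (simp add: fixed)
    also have "\<dots> \<le> r * (r ^ k * norm (z - ?P z))" using Suc r(1) by (rule mult_left_mono)
    finally show ?case by (simp add: mult.assoc)
  qed simp
  have "(\<lambda>k. (?T ^^ k) z) \<longlonglongrightarrow> ?P z" for z
  proof -
    have "(\<lambda>k. r ^ k * norm (z - ?P z)) \<longlonglongrightarrow> 0"
      using r by (intro tendsto_mult_left_zero LIMSEQ_power_zero) simp
    then have "(\<lambda>k. (?T ^^ k) z - ?P z) \<longlonglongrightarrow> 0"
      by (rule Lim_null_comparison[rotated]) (simp add: iter)
    then show ?thesis by (rule LIM_zero_cancel)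
  qed
  then show ?thesis using r main iter by blast
qed

end
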